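(* Consider the recurrence entanglement distillation algorithm described in the context, run on qubit pairs each initially in a state $$\rho=\tfrac12\big(|ab\rangle\langle ab|+e^{-\imath\alpha}R^{\dagger}|ab\rangle\langle a'b'|+e^{\imath\alpha}R\,|a'b'\rangle\langle ab|+|a'b'\rangle\langle a'b'|\big),$$ where $\{|a\rangle,|a'\rangle\}$ and $\{|b\rangle,|b'\rangle\}$ are orthonormal bases of $\mathbb{C}^2$, $\alpha\in[0,2\pi)$, $R\in\mathbb{C}$, $|R|\in[0,1]$. Let $F_0=\frac12(1+|R|)$. Then for every $k\ge1$, in the $k$-th round of distillation the source qubit pair is kept with fidelity (with respect to $|\Phi^+\rangle$) $$F_k=\frac{F_{k-1}^2}{F_{k-1}^2+(1-F_{k-1})^2},$$ probability $$P_k=F_{k-1}^2+(1-F_{k-1})^2,$$ and density matrix $$\rho^{(k)}=F_k|\Phi^+\rangle\langle\Phi^+|+(1-F_k)|\Psi^+\rangle\langle\Psi^+|.$$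
   Context: Notation: $\dagger$ denotes Hermitian transpose (complex conjugation for scalars), $\imath$ is the imaginary unit, $\{|0\rangle,|1\rangle\}$ is the computational basis of $\mathbb{C}^2$, $|\Phi^+\rangle=\frac1{\sqrt2}(|00\rangle+|11\rangle)$, $|\Psi^+\rangle=\frac1{\sqrt2}(|01\rangle+|10\rangle)$; in $|xy\rangle=|x\rangle\otimes|y\rangle$ the first factor is held by node Alice (A) and the second by node Bob (B). The fidelity of a two-qubit state $\sigma$ is $\langle\Phi^+|\sigma|\Phi^+\rangle$. Algorithm. Let $\theta=\alpha+\mathrm{Phase}\{R\}$. Local state preparation: on each qubit pair, Alice and Bob apply the local unitaries $$U_{\mathrm A}=\frac{|0\rangle+|1\rangle}{\sqrt2}\langle a|+\frac{|0\rangle-|1\rangle}{\sqrt2}\langle a'|,\qquad U_{\mathrm B}=\frac{|0\rangle+|1\rangle}{\sqrt2}\langle b|+e^{-\imath\theta}\frac{|0\rangle-|1\rangle}{\sqrt2}\langle b'|,$$ so that the state of each pair becomes $\rho^{(0)}=(U_{\mathrm A}\otimes U_{\mathrm B})\rho(U_{\mathrm A}\otimes U_{\mathrm B})^\dagger$. Round $k$ ($k=1,2,\dots$): take two kept qubit pairs, each in the state $\rho^{(k-1)}$ of pairs kept after the previous round (independent, so the joint state is $\rho^{(k-1)}\otimes\rho^{(k-1)}$); call the first the source pair and the second the target pair. (i) Each node applies the CNOT gate $|00\rangle\langle00|+|01\rangle\langle01|+|10\rangle\langle11|+|11\rangle\langle10|$ to its two qubits, with its qubit of the source pair as first (control) qubit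 and its qubit of the target pair as second (target) qubit. (ii) Each node measures its qubit of the target pair with the operators $|0\rangle\langle0|,|1\rangle\langle1|$, and the results are exchanged. (iii) If the two results agree, the source pair is kept; otherwise it is discarded. $P_k$ denotes the probability that the source pair is kept in round $k$, $\rho^{(k)}$ the density matrix of the source pair conditional on being kept, and $F_k=\langle\Phi^+|\rho^{(k)}|\Phi^+\rangle$ for $k\ge1$. *)

theory Defs
  imports "HOL-Analysis.Analysis"
begin

(* A qubit has index type 2 (elements 0 and 1), a compound system the product of the index types.
   A qubit pair has index type 2 * 2 (Alice's qubit, Bob's qubit), and two pairs have index type
   (2 * 2) * (2 * 2) (source pair, target pair). *)

type_synonym qubit = "complex ^ 2"
type_synonym qubit_pair = "complex ^ (2 \<times> 2)"
type_synonym qubit_op = "complex ^ 2 ^ 2"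
type_synonym pair_op = "complex ^ (2 \<times> 2) ^ (2 \<times> 2)"
type_synonym two_pairs_op =
  "complex ^ ((2 \<times> 2) \<times> (2 \<times> 2)) ^ ((2 \<times> 2) \<times> (2 \<times> 2))"

section \<open>Linear algebra in Dirac notation\<close>

(* The library's inner product on complex vectors is the real one, so the Hermitian form (conjugate
   linear in the first argument) is introduced here. *)
definition braket :: "complex ^ 'n \<Rightarrow> complex ^ 'n \<Rightarrow> complex" where
  "braket u v = (\<Sum>i\<in>UNIV. cnj (u $ i) * v $ i)"

definition ketbra :: "complex ^ 'm \<Rightarrow> complex ^ 'n \<Rightarrow> complex ^ 'n ^ 'm" where
  "ketbra u v = (\<chi> i j. u $ i * cnj (v $ j))"

definition dagger :: "complex ^ 'n ^ 'm \<Rightarrow> complex ^ 'm ^ 'n" where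
  "dagger A = (\<chi> i j. cnj (A $ j $ i))"

(* The library's \<open>*s\<close> on a matrix scales the columns separately by the entries of a vector. *)
definition cscale :: "complex \<Rightarrow> complex ^ 'n ^ 'm \<Rightarrow> complex ^ 'n ^ 'm" (infixr "*\<^sub>C" 75) where
  "c *\<^sub>C A = (\<chi> i j. c * A $ i $ j)"

definition tensor_vec ::
    "complex ^ 'm \<Rightarrow> complex ^ 'n \<Rightarrow> complex ^ ('m \<times> 'n)" (infixl "\<otimes>\<^sub>v" 76) where
  "u \<otimes>\<^sub>v v = (\<chi> i. u $ fst i * v $ snd i)"

definition tensor_op ::
    "complex ^ 'm ^ 'm \<Rightarrow> complex ^ 'n ^ 'n \<Rightarrow> complex ^ ('m \<times> 'n) ^ ('m \<times> 'n)"
    (infixl "\<otimes>\<^sub>o" 76) where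
  "A \<otimes>\<^sub>o B = (\<chi> i j. A $ fst i $ fst j * B $ snd i $ snd j)"

definition partial_trace_snd ::
    "complex ^ ('m::finite \<times> 'n::finite) ^ ('m \<times> 'n) \<Rightarrow> complex ^ 'm ^ 'm" where
  "partial_trace_snd A = (\<chi> i j. \<Sum>t\<in>UNIV. A $ (i, t) $ (j, t))"

definition orthonormal_basis :: "qubit \<Rightarrow> qubit \<Rightarrow> bool" where
  "orthonormal_basis u v \<longleftrightarrow>
     braket u u = 1 \<and> braket v v = 1 \<and> braket u v = 0 \<and> vec.span {u, v} = UNIV"

section \<open>Qubits\<close>

definition ket :: "2 \<Rightarrow> qubit" where
  "ket x = axis x 1"

definition ket_plus :: qubit where
  "ket_plus = (1 / sqrt 2) *\<^sub>R (ket 0 + ket 1)"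

definition ket_minus :: qubit where
  "ket_minus = (1 / sqrt 2) *\<^sub>R (ket 0 - ket 1)"

definition Phi_plus :: qubit_pair where
  "Phi_plus = (1 / sqrt 2) *\<^sub>R (ket 0 \<otimes>\<^sub>v ket 0 + ket 1 \<otimes>\<^sub>v ket 1)"

definition Psi_plus :: qubit_pair where
  "Psi_plus = (1 / sqrt 2) *\<^sub>R (ket 0 \<otimes>\<^sub>v ket 1 + ket 1 \<otimes>\<^sub>v ket 0)"

definition fidelity :: "pair_op \<Rightarrow> complex" where
  "fidelity \<sigma> = braket Phi_plus (\<sigma> *v Phi_plus)"

definition CNOT :: pair_op where
  "CNOT = ketbra (ket 0 \<otimes>\<^sub>v ket 0) (ket 0 \<otimes>\<^sub>v ket 0) + ketbra (ket 0 \<otimes>\<^sub>v ket 1) (ket 0 \<otimes>\<^sub>v ket 1)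
        + ketbra (ket 1 \<otimes>\<^sub>v ket 0) (ket 1 \<otimes>\<^sub>v ket 1) + ketbra (ket 1 \<otimes>\<^sub>v ket 1) (ket 1 \<otimes>\<^sub>v ket 0)"

section \<open>Initial state and local state preparation\<close>

definition initial_state ::
    "qubit \<Rightarrow> qubit \<Rightarrow> qubit \<Rightarrow> qubit \<Rightarrow> real \<Rightarrow> complex \<Rightarrow> pair_op" where
  "initial_state a a' b b' \<alpha> R =
     (1 / 2) *\<^sub>C
       (ketbra (a \<otimes>\<^sub>v b) (a \<otimes>\<^sub>v b)
        + (exp (- \<i> * \<alpha>) * cnj R) *\<^sub>C ketbra (a \<otimes>\<^sub>v b) (a' \<otimes>\<^sub>v b')
        + (exp (\<i> * \<alpha>) * R) *\<^sub>C ketbra (a' \<otimes>\<^sub>v b') (a \<otimes>\<^sub>v b)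
        + ketbra (a' \<otimes>\<^sub>v b') (a' \<otimes>\<^sub>v b'))"

definition U_A :: "qubit \<Rightarrow> qubit \<Rightarrow> qubit_op" where
  "U_A a a' = ketbra ket_plus a + ketbra ket_minus a'"

definition U_B :: "real \<Rightarrow> qubit \<Rightarrow> qubit \<Rightarrow> qubit_op" where
  "U_B \<theta> b b' = ketbra ket_plus b + exp (- \<i> * \<theta>) *\<^sub>C ketbra ket_minus b'"

definition prepared_state ::
    "qubit \<Rightarrow> qubit \<Rightarrow> qubit \<Rightarrow> qubit \<Rightarrow> real \<Rightarrow> complex \<Rightarrow> pair_op" where
  "prepared_state a a' b b' \<alpha> R =
     (let U = U_A a a' \<otimes>\<^sub>o U_B (\<alpha> + Arg R) b b'
      in U ** initial_state a a' b b' \<alpha> R ** dagger U)"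

section \<open>One round of distillation\<close>

(* In \<open>G \<otimes>\<^sub>o H\<close> the four qubits are ordered by node, ((A1, A2), (B1, B2)), whereas the joint state of
   the two pairs is ordered by pair, ((A1, B1), (A2, B2)); 1 is the source and 2 the target. *)
fun by_node :: "(2 \<times> 2) \<times> (2 \<times> 2) \<Rightarrow> (2 \<times> 2) \<times> (2 \<times> 2)" where
  "by_node ((a1, b1), (a2, b2)) = ((a1, a2), (b1, b2))"

definition local_gates :: "pair_op \<Rightarrow> pair_op \<Rightarrow> two_pairs_op" where
  "local_gates G H = (\<chi> i j. (G \<otimes>\<^sub>o H) $ by_node i $ by_node j)"

definition after_CNOT :: "pair_op \<Rightarrow> two_pairs_op" where
  "after_CNOT \<rho> = (let C = local_gates CNOT CNOT in C ** (\<rho> \<otimes>\<^sub>o \<rho>) ** dagger C)"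

(* Alice obtains x and Bob obtains y on the target pair; the source pair is not touched. *)
definition measure_target :: "2 \<Rightarrow> 2 \<Rightarrow> two_pairs_op" where
  "measure_target x y = mat 1 \<otimes>\<^sub>o (ketbra (ket x) (ket x) \<otimes>\<^sub>o ketbra (ket y) (ket y))"

(* Not normalized: its trace is the probability that the two results agree. *)
definition agreeing_part :: "pair_op \<Rightarrow> two_pairs_op" where
  "agreeing_part \<rho> =
     (\<Sum>(x, y) \<in> {(x, y). x = y}.
        measure_target x y ** after_CNOT \<rho> ** dagger (measure_target x y))"

definition keep_prob :: "pair_op \<Rightarrow> complex" where
  "keep_prob \<rho> = trace (agreeing_part \<rho>)"

definition kept_state :: "pair_op \<Rightarrow> pair_op" where
  "kept_state \<rho> = (1 / keep_prob \<rho>) *\<^sub>C partial_trace_snd (agreeing_part \<rho>)"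

primrec distilled_state :: "pair_op \<Rightarrow> nat \<Rightarrow> pair_op" where
  "distilled_state \<rho>\<^sub>0 0 = \<rho>\<^sub>0"
| "distilled_state \<rho>\<^sub>0 (Suc k) = kept_state (distilled_state \<rho>\<^sub>0 k)"

end

theory Submission
  imports Defs
begin

text \<open>Local preparation turns \<open>|ab\<rangle>\<close> and \<open>|a'b'\<rangle>\<close> into \<open>|++\<rangle>\<close> and \<open>|--\<rangle>\<close>, up to a phase that makes the
coherence equal to \<open>|R|\<close>; the result is a mixture of \<open>\<Phi>\<^sup>+\<close> and \<open>\<Psi>\<^sup>+\<close>. The density matrix of such a
mixture is supported on entries whose row and column have the same parity, and its value there
depends on the parity only. The bilateral CNOT permutes the computational basis, adding the source
bits to the target bits; agreement of the two target results then forces the parities of source and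
target to coincide, so that a round squares both weights and renormalizes.\<close>

section \<open>Computational basis\<close>

lemma UNIV_qubit: "(UNIV :: 2 set) = {0, 1}"
  using exhaust_2 by force

lemma qubit_index_cases: "i = 0 \<or> i = 1" for i :: 2
  using exhaust_2[of i] by force

text \<open>Arithmetic in the index type \<open>2\<close> is modulo 2, so \<open>+\<close> on
  indices is exclusive or and \<open>fst i + snd i\<close> is the parity of a basis label.\<close>

lemma two_qubit [simp]: "2 = (0 :: 2)"
  by simp

lemma add_self_qubit [simp]: "i + i = 0" for i :: 2
  using qubit_index_cases[of i] by auto

lemma add_self_left_qubit [simp]: "i + (i + j) = j" for i j :: 2
  by (simp flip: add.assoc)

lemma ket_nth: "ket x $ i = (if i = x then 1 else 0)"
  by (simp add: ket_def axis_def)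

lemma ket_plus_nth: "ket_plus $ i = 1 / sqrt 2"
  using qubit_index_cases[of i] by (auto simp: ket_plus_def ket_nth scaleR_conv_of_real[where 'a = complex])

lemma ket_minus_nth: "ket_minus $ i = (if i = 0 then 1 else - 1) / sqrt 2"
  using qubit_index_cases[of i] by (auto simp: ket_minus_def ket_nth scaleR_conv_of_real[where 'a = complex])

lemma Phi_plus_nth: "Phi_plus $ i = (if fst i + snd i = 0 then 1 / sqrt 2 else 0)"
  using qubit_index_cases[of "fst i"] qubit_index_cases[of "snd i"]
  by (auto simp: Phi_plus_def tensor_vec_def ket_nth scaleR_conv_of_real[where 'a = complex])

lemma Psi_plus_nth: "Psi_plus $ i = (if fst i + snd i = 0 then 0 else 1 / sqrt 2)"
  using qubit_index_cases[of "fst i"] qubit_index_cases[of "snd i"]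
  by (auto simp: Psi_plus_def tensor_vec_def ket_nth scaleR_conv_of_real[where 'a = complex])

lemma CNOT_nth: "CNOT $ i $ j = (if i = (fst j, fst j + snd j) then 1 else 0)"
  using qubit_index_cases[of "fst i"] qubit_index_cases[of "snd i"]
    qubit_index_cases[of "fst j"] qubit_index_cases[of "snd j"]
  by (auto simp: CNOT_def ketbra_def tensor_vec_def ket_nth prod_eq_iff)

lemma of_real_sqrt2_mult [simp]: "complex_of_real (sqrt 2) * complex_of_real (sqrt 2) = 2"
  by (simp flip: of_real_mult)

section \<open>Matrices in Dirac notation\<close>

lemma matrix_mult_ketbra: "A ** ketbra u v = ketbra (A *v u) v"
  by (simp add: vec_eq_iff matrix_matrix_mult_def matrix_vector_mult_def ketbra_def
      sum_distrib_right mult.assoc)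

lemma ketbra_mult_dagger: "ketbra u v ** dagger A = ketbra u (A *v v)"
  by (simp add: vec_eq_iff matrix_matrix_mult_def matrix_vector_mult_def ketbra_def dagger_def
      sum_distrib_left mult_ac)

lemma matrix_add_rdistrib: "(A + B) ** C = A ** C + B ** C"
  by (simp add: vec_eq_iff matrix_matrix_mult_def distrib_right sum.distrib)

lemma matrix_mult_cscale: "A ** (c *\<^sub>C B) = c *\<^sub>C (A ** B)"
  by (simp add: vec_eq_iff matrix_matrix_mult_def cscale_def sum_distrib_left mult_ac)

lemma cscale_matrix_mult: "(c *\<^sub>C A) ** B = c *\<^sub>C (A ** B)"
  by (simp add: vec_eq_iff matrix_matrix_mult_def cscale_def sum_distrib_left mult_ac)

lemma ketbra_mult_vec: "ketbra u v *v w = braket v w *s u"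
  by (simp add: vec_eq_iff matrix_vector_mult_def ketbra_def braket_def sum_distrib_right
      sum_distrib_left mult_ac)

lemma cscale_mult_vec: "(c *\<^sub>C A) *v w = c *s (A *v w)"
  by (simp add: vec_eq_iff matrix_vector_mult_def cscale_def sum_distrib_left mult_ac)

lemma tensor_op_mult_tensor_vec: "(A \<otimes>\<^sub>o B) *v (u \<otimes>\<^sub>v v) = (A *v u) \<otimes>\<^sub>v (B *v v)"
  by (simp add: vec_eq_iff matrix_vector_mult_def tensor_op_def tensor_vec_def sum_product
      sum.cartesian_product UNIV_Times_UNIV[symmetric] case_prod_beta mult_ac
      del: UNIV_Times_UNIV)

lemma braket_commute: "braket v u = cnj (braket u v)"
  by (simp add: braket_def mult.commute)

lemma braket_add_right: "braket u (v + w) = braket u v + braket u w"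
  by (simp add: braket_def distrib_left sum.distrib)

lemma braket_smult_right: "braket u (c *s v) = c * braket u v"
  by (simp add: braket_def sum_distrib_left mult_ac)

text \<open>\<open>C\<close> is the permutation matrix of \<open>p\<close>. Conjugation relabels
  rows and columns by the inverse permutation, which is \<open>p\<close> itself.\<close>

lemma involution_conjugate_nth:
  fixes p :: "'n::finite \<Rightarrow> 'n"
  assumes "\<And>i. p (p i) = i"
  defines "C \<equiv> (\<chi> i j. if i = p j then 1 else 0) :: complex ^ 'n ^ 'n"
  shows "(C ** A ** dagger C) $ i $ j = A $ p i $ p j"
proof -
  have eq: "i = p j \<longleftrightarrow> j = p i" for i j
    using assms(1) by metis
  show ?thesis
    by (simp add: C_def matrix_matrix_mult_def dagger_def eq if_distrib[of cnj]
        if_distrib[of "\<lambda>x. x * _"] if_distrib[of "\<lambda>x. _ * x"] cong: if_cong)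
qed

section \<open>Mixtures of the two Bell states\<close>

text \<open>The weight is complex to match the type of \<open>fidelity\<close> and
  \<open>keep_prob\<close>; that it is real is tracked separately.\<close>

definition bell_mixture :: "complex \<Rightarrow> pair_op" where
  "bell_mixture p = p *\<^sub>C ketbra Phi_plus Phi_plus + (1 - p) *\<^sub>C ketbra Psi_plus Psi_plus"

lemma bell_mixture_nth:
  "bell_mixture p $ i $ j =
     (if fst i + snd i = fst j + snd j then (if fst i + snd i = 0 then p else 1 - p) / 2 else 0)"
  using qubit_index_cases[of "fst i"] qubit_index_cases[of "snd i"]
    qubit_index_cases[of "fst j"] qubit_index_cases[of "snd j"]
  by (auto simp: bell_mixture_def cscale_def ketbra_def Phi_plus_nth Psi_plus_nth)

lemma fidelity_bell_mixture: "fidelity (bell_mixture p) = p"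
proof -
  have "braket Phi_plus Phi_plus = 1" "braket Psi_plus Phi_plus = 0"
    by (simp_all add: braket_def Phi_plus_nth Psi_plus_nth UNIV_Times_UNIV[symmetric] UNIV_qubit
        Sigma_def del: UNIV_Times_UNIV)
  then show ?thesis
    by (simp add: fidelity_def bell_mixture_def matrix_vector_mult_add_rdistrib cscale_mult_vec
        ketbra_mult_vec braket_add_right braket_smult_right)
qed

lemma rotate_initial_state:
  assumes "U *v (a \<otimes>\<^sub>v b) = u" "U *v (a' \<otimes>\<^sub>v b') = v"
  shows "U ** initial_state a a' b b' \<alpha> R ** dagger U =
    (1 / 2) *\<^sub>C (ketbra u u + (exp (- \<i> * \<alpha>) * cnj R) *\<^sub>C ketbra u v
      + (exp (\<i> * \<alpha>) * R) *\<^sub>C ketbra v u + ketbra v v)"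
  by (simp add: initial_state_def matrix_mult_cscale cscale_matrix_mult matrix_add_ldistrib
      matrix_add_rdistrib matrix_mult_ketbra ketbra_mult_dagger assms)

text \<open>Since |++> and |--> are the sum and difference of \<open>Phi_plus\<close> and
  \<open>Psi_plus\<close> over \<open>sqrt 2\<close>, a real coherence cancels the cross terms
  between the Bell states and shifts their weights to (1 + |R|)/2 and (1 - |R|)/2.\<close>

lemma prepared_state_eq_bell_mixture:
  assumes "orthonormal_basis a a'" "orthonormal_basis b b'"
  shows "prepared_state a a' b b' \<alpha> R = bell_mixture (1 / 2 * (1 + cmod R))"
proof -
  define \<phi> where "\<phi> = exp (- \<i> * complex_of_real (\<alpha> + Arg R))"
  define U where "U = U_A a a' \<otimes>\<^sub>o U_B (\<alpha> + Arg R) b b'"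
  define u where "u = ket_plus \<otimes>\<^sub>v ket_plus"
  define v where "v = ket_minus \<otimes>\<^sub>v (\<phi> *s ket_minus)"
  have a: "braket a a = 1" "braket a' a' = 1" "braket a a' = 0" "braket a' a = 0"
    and b: "braket b b = 1" "braket b' b' = 1" "braket b b' = 0" "braket b' b = 0"
    using assms braket_commute[of a' a] braket_commute[of b' b]
    by (auto simp: orthonormal_basis_def)
  have U: "U *v (a \<otimes>\<^sub>v b) = u" "U *v (a' \<otimes>\<^sub>v b') = v"
    by (simp_all add: U_def u_def v_def \<phi>_def U_A_def U_B_def tensor_op_mult_tensor_vec
        matrix_vector_mult_add_rdistrib cscale_mult_vec ketbra_mult_vec a b)
  \<comment> \<open>For \<open>R = 0\<close> both sides vanish, whatever value \<open>Arg\<close>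
    takes there.\<close>
  have "R = cmod R * exp (\<i> * Arg R)"
    using Arg_eq[of R] by (cases "R = 0") auto
  then have "exp (\<i> * \<alpha>) * R * \<phi> = cmod R * (exp (\<i> * \<alpha>) * exp (\<i> * Arg R) * \<phi>)"
    by (metis mult.assoc mult.left_commute)
  also have "exp (\<i> * \<alpha>) * exp (\<i> * Arg R) * \<phi> = 1"
    by (simp add: \<phi>_def distrib_left flip: exp_add)
  finally have phase: "exp (\<i> * \<alpha>) * R * \<phi> = cmod R"
    by simp
  have cnj_phase: "exp (- \<i> * \<alpha>) * cnj R * cnj \<phi> = cmod R"
    using arg_cong[OF phase, of cnj] by (simp add: exp_cnj)
  have norm: "\<phi> * cnj \<phi> = 1"
    by (simp add: \<phi>_def exp_cnj flip: exp_add)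
  have "prepared_state a a' b b' \<alpha> R = (1 / 2) *\<^sub>C (ketbra u u
      + (exp (- \<i> * \<alpha>) * cnj R) *\<^sub>C ketbra u v + (exp (\<i> * \<alpha>) * R) *\<^sub>C ketbra v u + ketbra v v)"
    using rotate_initial_state[OF U] by (simp add: prepared_state_def U_def Let_def)
  also have "\<dots> = bell_mixture (1 / 2 * (1 + cmod R))"
  proof -
    define s where "s i = (if fst i + snd i = 0 then 1 else - 1 :: complex)" for i :: "2 \<times> 2"
    have u: "u $ i = 1 / 2" for i
      by (simp add: u_def tensor_vec_def ket_plus_nth)
    have v: "v $ i = \<phi> * s i / 2" for i
      using qubit_index_cases[of "fst i"] qubit_index_cases[of "snd i"]
      by (auto simp: v_def s_def tensor_vec_def ket_minus_nth)
    have s: "cnj (s i) = s i" for i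
      by (simp add: s_def)
    \<comment> \<open>The factor \<open>1 / 8\<close> collects the prefactor and two entries of
      modulus \<open>1 / 2\<close>; the parenthesised products are those that \<open>phase\<close>,
      \<open>cnj_phase\<close> and \<open>norm\<close> evaluate.\<close>
    have "1 / 2 * (u $ i * cnj (u $ j) + exp (- \<i> * \<alpha>) * cnj R * (u $ i * cnj (v $ j))
        + exp (\<i> * \<alpha>) * R * (v $ i * cnj (u $ j)) + v $ i * cnj (v $ j))
      = 1 / 8 * (1 + (exp (- \<i> * \<alpha>) * cnj R * cnj \<phi>) * s j + (exp (\<i> * \<alpha>) * R * \<phi>) * s i
        + (\<phi> * cnj \<phi>) * s i * s j)" for i j
      by (simp add: u v s algebra_simps)
    \<comment> \<open>Equal signs \<open>s i = s j\<close> give (1 + |R|)/4 or (1 - |R|)/4; for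
      opposite signs all terms cancel.\<close>
    also have "\<dots> i j = bell_mixture (1 / 2 * (1 + cmod R)) $ i $ j" for i j
      unfolding phase cnj_phase norm
      using qubit_index_cases[of "fst i + snd i"] qubit_index_cases[of "fst j + snd j"]
      by (auto simp: bell_mixture_nth s_def field_simps)
    finally show ?thesis
      by (simp add: vec_eq_iff cscale_def ketbra_def)
  qed
  finally show ?thesis .
qed

section \<open>One round\<close>

text \<open>Labels are ordered by pair here, so that source and target can be separated
  directly.\<close>

fun bilateral_cnot :: "(2 \<times> 2) \<times> (2 \<times> 2) \<Rightarrow> (2 \<times> 2) \<times> (2 \<times> 2)" where
  "bilateral_cnot ((a1, b1), (a2, b2)) = ((a1, b1), (a1 + a2, b1 + b2))"

lemma bilateral_cnot_involution: "bilateral_cnot (bilateral_cnot i) = i"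
  by (cases i rule: bilateral_cnot.cases) simp

lemma local_gates_CNOT:
  "local_gates CNOT CNOT = (\<chi> i j. if i = bilateral_cnot j then 1 else 0)"
proof -
  have "(CNOT \<otimes>\<^sub>o CNOT) $ by_node i $ by_node j = (if i = bilateral_cnot j then 1 else 0)" for i j
    by (cases i rule: bilateral_cnot.cases; cases j rule: bilateral_cnot.cases)
      (auto simp: tensor_op_def CNOT_nth)
  then show ?thesis
    by (simp add: local_gates_def)
qed

lemma after_CNOT_nth:
  "after_CNOT \<rho> $ i $ j = (\<rho> \<otimes>\<^sub>o \<rho>) $ bilateral_cnot i $ bilateral_cnot j"
  unfolding after_CNOT_def Let_def local_gates_CNOT
  by (rule involution_conjugate_nth[OF bilateral_cnot_involution])

section \<open>Measurement of the target pair\<close>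

lemma measure_target_nth:
  "measure_target x y $ i $ j = (if i = j \<and> snd j = (x, y) then 1 else 0)"
  by (auto simp: measure_target_def tensor_op_def mat_def ketbra_def ket_nth prod_eq_iff)

lemma measure_target_conjugate_nth:
  "(measure_target x y ** A ** dagger (measure_target x y)) $ i $ j =
     (if snd i = (x, y) \<and> snd j = (x, y) then A $ i $ j else 0)"
proof -
  have l: "(measure_target x y ** A) $ i $ j = (if snd i = (x, y) then A $ i $ j else 0)" for i j
  proof -
    have "(measure_target x y ** A) $ i $ j = (\<Sum>k\<in>UNIV. measure_target x y $ i $ k * A $ k $ j)"
      by (simp add: matrix_matrix_mult_def)
    also have "\<dots> = (\<Sum>k\<in>UNIV. if i = k then (if snd i = (x, y) then A $ k $ j else 0) else 0)"
      by (rule sum.cong) (auto simp: measure_target_nth)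
    finally show ?thesis by simp
  qed
  have "(measure_target x y ** A ** dagger (measure_target x y)) $ i $ j
    = (\<Sum>k\<in>UNIV. (measure_target x y ** A) $ i $ k * cnj (measure_target x y $ j $ k))"
    by (simp add: matrix_matrix_mult_def[of "measure_target x y ** A"] dagger_def)
  also have "\<dots> = (\<Sum>k\<in>UNIV. if j = k
      then (if snd j = (x, y) then (measure_target x y ** A) $ i $ k else 0) else 0)"
    by (rule sum.cong) (auto simp: measure_target_nth)
  finally show ?thesis by (simp add: l)
qed

text \<open>Each diagonal projector keeps one block; coherences between the outcomes 00 and 11 are
  lost, hence the condition \<open>snd i = snd j\<close>.\<close>

lemma agreeing_part_nth:
  "agreeing_part \<rho> $ i $ j =
     (if snd i = snd j \<and> fst (snd i) = snd (snd i) then after_CNOT \<rho> $ i $ j else 0)"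
proof -
  have "{(x, y). x = y} = {(0, 0), (1, 1 :: 2)}"
    using qubit_index_cases by auto
  then show ?thesis
    using qubit_index_cases[of "fst (snd i)"] qubit_index_cases[of "fst (snd j)"]
    by (auto simp: agreeing_part_def measure_target_conjugate_nth prod_eq_iff)
qed

lemma sum_UNIV_pair: "(\<Sum>t\<in>UNIV. f t) = (\<Sum>x\<in>UNIV. \<Sum>y\<in>UNIV. f (x, y))"
  for f :: "'a::finite \<times> 'b::finite \<Rightarrow> 'c::comm_monoid_add"
  by (simp add: sum.cartesian_product)

lemma trace_partial_trace_snd: "trace (partial_trace_snd A) = trace A"
  by (simp add: trace_def partial_trace_snd_def sum_UNIV_pair[of "\<lambda>i. A $ i $ i"])

text \<open>Undoing the bilateral CNOT leaves the source label fixed and turns the target result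
  \<open>(t, t)\<close> into the source label shifted by \<open>t\<close> in both bits.\<close>

lemma partial_trace_agreeing_part_nth:
  "partial_trace_snd (agreeing_part \<rho>) $ i $ j =
     \<rho> $ i $ j * (\<Sum>t\<in>UNIV. \<rho> $ (fst i + t, snd i + t) $ (fst j + t, snd j + t))"
proof (cases i; cases j)
  fix a b c d assume i: "i = (a, b)" and j: "j = (c, d)"
  have "partial_trace_snd (agreeing_part \<rho>) $ i $ j
    = (\<Sum>x\<in>UNIV. \<Sum>y\<in>UNIV. agreeing_part \<rho> $ (i, (x, y)) $ (j, (x, y)))"
    by (simp add: partial_trace_snd_def sum_UNIV_pair)
  also have "\<dots> = (\<Sum>x\<in>UNIV. \<rho> $ i $ j * \<rho> $ (a + x, b + x) $ (c + x, d + x))"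
    by (simp add: agreeing_part_nth after_CNOT_nth tensor_op_def i j)
  finally show ?thesis
    by (simp add: i j sum_distrib_left)
qed

text \<open>Shifting both bits by \<open>t\<close> preserves parity, so both values of
  \<open>t\<close> contribute the same entry: \<open>p / 2\<close> times \<open>2 * (p / 2)\<close>
  on the even block, likewise with \<open>1 - p\<close> on the odd one.\<close>

lemma partial_trace_agreeing_part_bell_mixture:
  "partial_trace_snd (agreeing_part (bell_mixture p)) $ i $ j =
     (if fst i + snd i = fst j + snd j then (if fst i + snd i = 0 then p\<^sup>2 else (1 - p)\<^sup>2) / 2 else 0)"
proof -
  have "fst i + t + (snd i + t) = fst i + snd i" for i :: "2 \<times> 2" and t
    using add.assoc add.commute add_self_left_qubit by metis
  then show ?thesis
    by (simp add: partial_trace_agreeing_part_nth bell_mixture_nth power2_eq_square)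
qed

text \<open>The partial trace preserves the trace, and each parity occurs at two diagonal
  positions.\<close>

lemma keep_prob_bell_mixture: "keep_prob (bell_mixture p) = p\<^sup>2 + (1 - p)\<^sup>2"
proof -
  have "keep_prob (bell_mixture p) = trace (partial_trace_snd (agreeing_part (bell_mixture p)))"
    by (simp add: keep_prob_def trace_partial_trace_snd)
  also have "\<dots> = p\<^sup>2 + (1 - p)\<^sup>2"
    by (simp add: trace_def partial_trace_agreeing_part_bell_mixture sum_UNIV_pair UNIV_qubit)
  finally show ?thesis .
qed

lemma kept_state_bell_mixture:
  assumes "p\<^sup>2 + (1 - p)\<^sup>2 \<noteq> 0"
  shows "kept_state (bell_mixture p) = bell_mixture (p\<^sup>2 / (p\<^sup>2 + (1 - p)\<^sup>2))"
proof -
  have "1 - p\<^sup>2 / (p\<^sup>2 + (1 - p)\<^sup>2) = (1 - p)\<^sup>2 / (p\<^sup>2 + (1 - p)\<^sup>2)"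
    using assms by (simp add: divide_simps)
  then show ?thesis
    by (simp add: vec_eq_iff kept_state_def cscale_def keep_prob_bell_mixture
        partial_trace_agreeing_part_bell_mixture bell_mixture_nth)
qed

text \<open>Two real squares vanish together only if \<open>p = 0\<close> and \<open>p = 1\<close>.
  Over the complex numbers the sum has roots, namely (1 + i)/2 and (1 - i)/2.\<close>

lemma keep_prob_real_nonzero:
  assumes "p \<in> \<real>"
  shows "p\<^sup>2 + (1 - p)\<^sup>2 \<noteq> (0 :: complex)"
proof -
  obtain r where p: "p = complex_of_real r"
    using assms by (rule Reals_cases)
  have "r\<^sup>2 + (1 - r)\<^sup>2 \<noteq> 0"
    by (simp add: sum_power2_eq_zero_iff)
  then have "complex_of_real (r\<^sup>2 + (1 - r)\<^sup>2) \<noteq> 0"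
    by (simp only: of_real_eq_0_iff not_False_eq_True)
  then show ?thesis
    by (simp add: p)
qed

theorem theorem3:
  fixes a a' b b' :: qubit and \<alpha> :: real and R :: complex
    and \<rho> :: "nat \<Rightarrow> pair_op" and F P :: "nat \<Rightarrow> complex"
  assumes "orthonormal_basis a a'" and "orthonormal_basis b b'"
    and "0 \<le> \<alpha>" and "\<alpha> < 2 * pi" and "cmod R \<le> 1"
    and "\<And>k. \<rho> k = distilled_state (prepared_state a a' b b' \<alpha> R) k"
    and "F 0 = 1 / 2 * (1 + cmod R)"
    and "\<And>k. k \<ge> 1 \<Longrightarrow> F k = fidelity (\<rho> k)"
    and "\<And>k. k \<ge> 1 \<Longrightarrow> P k = keep_prob (\<rho> (k - 1))"
  shows "\<forall>k\<ge>1.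
      F k = (F (k - 1))\<^sup>2 / ((F (k - 1))\<^sup>2 + (1 - F (k - 1))\<^sup>2)
    \<and> P k = (F (k - 1))\<^sup>2 + (1 - F (k - 1))\<^sup>2
    \<and> \<rho> k = F k *\<^sub>C ketbra Phi_plus Phi_plus + (1 - F k) *\<^sub>C ketbra Psi_plus Psi_plus"
proof -
  have step: "\<rho> (Suc k) = bell_mixture (F (Suc k))"
      "F (Suc k) = (F k)\<^sup>2 / ((F k)\<^sup>2 + (1 - F k)\<^sup>2)"
    if "\<rho> k = bell_mixture (F k)" "F k \<in> \<real>" for k
  proof -
    have \<rho>: "\<rho> (Suc k) = bell_mixture ((F k)\<^sup>2 / ((F k)\<^sup>2 + (1 - F k)\<^sup>2))"
      using kept_state_bell_mixture[OF keep_prob_real_nonzero] that by (simp add: assms(6))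
    then show "F (Suc k) = (F k)\<^sup>2 / ((F k)\<^sup>2 + (1 - F k)\<^sup>2)"
      by (simp add: assms(8) fidelity_bell_mixture)
    with \<rho> show "\<rho> (Suc k) = bell_mixture (F (Suc k))" by simp
  qed
  \<comment> \<open>Realness of \<open>F k\<close> belongs to the invariant because it keeps the
    next normalization nonzero.\<close>
  have inv: "\<rho> k = bell_mixture (F k) \<and> F k \<in> \<real>" for k
  proof (induction k)
    case 0
    have "F 0 = complex_of_real (1 / 2 * (1 + cmod R))"
      using assms(7) by simp
    then have "F 0 \<in> \<real>" by (metis Reals_of_real)
    then show ?case
      using prepared_state_eq_bell_mixture[OF assms(1,2)] by (simp add: assms(6,7))
  next
    case (Suc k)
    then show ?case using step[of k] by simp
  qed
  show ?thesis
  proof (intro allI impI)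
    fix k :: nat assume "1 \<le> k"
    then obtain n where k: "k = Suc n" by (cases k) auto
    show "F k = (F (k - 1))\<^sup>2 / ((F (k - 1))\<^sup>2 + (1 - F (k - 1))\<^sup>2)
      \<and> P k = (F (k - 1))\<^sup>2 + (1 - F (k - 1))\<^sup>2
      \<and> \<rho> k = F k *\<^sub>C ketbra Phi_plus Phi_plus + (1 - F k) *\<^sub>C ketbra Psi_plus Psi_plus"
      \<comment> \<open>\<open>P k\<close> depends on the state entering the round, index
        \<open>n\<close>; the kept state has index \<open>k\<close>.\<close>
      using inv[of n] inv[of k] step(2)[of n]
      by (simp add: k assms(9) keep_prob_bell_mixture bell_mixture_def[symmetric])
  qed
qed

end
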